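(* Let $m>n>0$ and $d\ge1$. For $\mathbf{k}=(k_1,\dots,k_d)\in\mathbb{Z}_{\ge0}^d$ put $l=k_1^2+\cdots+k_d^2$ and $$\lambda_{\mathbf{k},+}=\frac{-(n\pi^2l+1)+\sqrt{(n\pi^2l+1)^2-4(n-m)\pi^2l}}{2}.$$ Then $\lambda_{\mathbf{k},+}$ is an increasing function of $\sqrt l$ (a larger value of $\sqrt l$ gives a larger value of $\lambda_{\mathbf{k},+}$), $\lambda_{\mathbf{0},+}=0$, and for all $\mathbf{k}\neq\mathbf{0}$ $$0<\lambda_{\mathbf{k},+}<\frac{m-n}{n}.$$
   Context: $\lambda_{\mathbf{k},+}$ is the larger of the two (real) eigenvalues of the matrix $A_{\mathbf{k}}=\begin{bmatrix}-n\pi^2l&\pi^2l\\ m&-1\end{bmatrix}$, which governs the $\mathbf{k}$-th cosine Fourier mode of the linearization of $\partial_tu=\Delta(u^n/\gamma)$, $\partial_t\gamma=-\gamma+u^m$ around $(1,1)$ on $[0,1]^d$ with Neumann boundary conditions. *)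

theory Defs
  imports "HOL-Analysis.Analysis"
begin

definition mode_l :: "nat ^ 'd \<Rightarrow> real" where
  "mode_l k = (\<Sum>i\<in>UNIV. (real (k $ i))\<^sup>2)"

text \<open>The larger root of the characteristic polynomial
  \<open>X\<^sup>2 + (n \<pi>\<^sup>2 l + 1) X + (n - m) \<pi>\<^sup>2 l\<close> of the matrix
  \<open>[[- n \<pi>\<^sup>2 l, \<pi>\<^sup>2 l], [m, -1]]\<close>, where \<open>l = mode_l k\<close>.\<close>

definition lambda_plus :: "real \<Rightarrow> real \<Rightarrow> nat ^ 'd \<Rightarrow> real" where
  "lambda_plus n m k =
     (- (n * pi\<^sup>2 * mode_l k + 1)
      + sqrt ((n * pi\<^sup>2 * mode_l k + 1)\<^sup>2 - 4 * (n - m) * pi\<^sup>2 * mode_l k)) / 2"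

end

theory Submission
  imports Defs
begin

text \<open>With \<open>x = \<pi>\<^sup>2 l\<close> the larger root \<open>r\<close> satisfies \<open>r (r + 1) = x (m - n - n r)\<close>.
  For \<open>x > 0\<close> the left side is positive, which gives the upper bound. The left side increases with
  \<open>r\<close> and the second factor on the right decreases with it, so \<open>r\<close> must increase with \<open>x\<close>.\<close>

lemma mode_l_nonneg: "mode_l k \<ge> 0"
  unfolding mode_l_def by (intro sum_nonneg) simp

lemma mode_l_eq_0_iff: "mode_l k = 0 \<longleftrightarrow> k = 0"
  unfolding mode_l_def by (simp add: sum_nonneg_eq_0_iff vec_eq_iff)

lemma mode_l_pos_iff: "mode_l k > 0 \<longleftrightarrow> k \<noteq> 0"
  using mode_l_nonneg[of k] mode_l_eq_0_iff[of k] by linarith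

lemma lambda_plus_0: "lambda_plus n m 0 = 0"
  by (simp add: lambda_plus_def mode_l_eq_0_iff[THEN iffD2])

text \<open>For \<open>m > n\<close> the constant term
  \<open>(n - m) * pi\<^sup>2 * mode_l k\<close> of the characteristic polynomial is negative, so
  the square root exceeds \<open>n * pi\<^sup>2 * mode_l k + 1\<close>.\<close>

lemma lambda_plus_pos:
  assumes "n > 0" "m > n" "k \<noteq> 0"
  shows "lambda_plus n m k > 0"
proof -
  have "(m - n) * (pi\<^sup>2 * mode_l k) > 0"
    using assms by (simp add: mode_l_pos_iff)
  then have "(n * pi\<^sup>2 * mode_l k + 1)\<^sup>2
      < (n * pi\<^sup>2 * mode_l k + 1)\<^sup>2 - 4 * (n - m) * pi\<^sup>2 * mode_l k"
    by (simp add: algebra_simps)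
  then show ?thesis
    unfolding lambda_plus_def using real_less_rsqrt by fastforce
qed

lemma lambda_plus_nonneg:
  assumes "n > 0" "m > n"
  shows "lambda_plus n m k \<ge> 0"
  using lambda_plus_pos[OF assms, of k] by (cases "k = 0") (simp_all add: lambda_plus_0)

text \<open>This is the characteristic equation, rearranged so that the mode enters the right side
  explicitly only through the factor \<open>pi\<^sup>2 * mode_l k\<close>.\<close>

lemma lambda_plus_root:
  assumes "m \<ge> n"
  shows "lambda_plus n m k * (lambda_plus n m k + 1)
    = pi\<^sup>2 * mode_l k * (m - n - n * lambda_plus n m k)"
proof -
  define x where "x = pi\<^sup>2 * mode_l k"
  \<comment> \<open>Writing the radicand with \<open>m - n\<close> makes it visibly nonnegative, so
    squaring undoes the root.\<close>
  define s where "s = sqrt ((n * x + 1)\<^sup>2 + 4 * (m - n) * x)"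
  have "x \<ge> 0"
    by (simp add: x_def mode_l_nonneg)
  then have s2: "s\<^sup>2 = (n * x + 1)\<^sup>2 + 4 * (m - n) * x"
    unfolding s_def using assms by simp
  have root: "lambda_plus n m k = (s - (n * x + 1)) / 2"
    by (simp add: lambda_plus_def s_def x_def algebra_simps)
  show ?thesis
    unfolding x_def[symmetric] root using s2 by (simp add: field_simps power2_eq_square)
qed

text \<open>The bound is kept free of division to match the factor in
  \<open>lambda_plus_root\<close>. At \<open>k = 0\<close> that equation reads \<open>0 = 0\<close>,
  hence the case split.\<close>

lemma lambda_plus_less:
  assumes "n > 0" "m > n"
  shows "n * lambda_plus n m k < m - n"
proof (cases "k = 0")
  case True
  then show ?thesis using assms by (simp add: lambda_plus_0)
next
  case False
  let ?r = "lambda_plus n m k"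
  have "?r * (?r + 1) > 0"
    using lambda_plus_pos[OF assms False] by simp
  then have "pi\<^sup>2 * mode_l k * (m - n - n * ?r) > 0"
    using lambda_plus_root[of n m k] assms by simp
  moreover have "pi\<^sup>2 * mode_l k > 0"
    using False by (simp add: mode_l_pos_iff)
  ultimately show ?thesis
    by (simp add: zero_less_mult_iff)
qed

lemma lambda_plus_strict_mono:
  assumes "n > 0" "m > n" "mode_l k < mode_l k'"
  shows "lambda_plus n m k < lambda_plus n m k'"
proof (rule ccontr)
  let ?r = "lambda_plus n m k" and ?s = "lambda_plus n m k'"
  assume "\<not> ?r < ?s"
  then have le: "?s \<le> ?r" by simp
  have "pi\<^sup>2 * mode_l k' * (m - n - n * ?s) = ?s * (?s + 1)"
    using lambda_plus_root assms by (metis less_imp_le)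
  \<comment> \<open>Monotonicity of \<open>t * (t + 1)\<close> is applied on
    \<open>t \<ge> 0\<close>, where both roots lie.\<close>
  also have "\<dots> \<le> ?r * (?r + 1)"
    using le lambda_plus_nonneg[OF assms(1,2), of k'] by (intro mult_mono) auto
  also have "\<dots> = pi\<^sup>2 * mode_l k * (m - n - n * ?r)"
    using lambda_plus_root assms by (metis less_imp_le)
  also have "\<dots> \<le> pi\<^sup>2 * mode_l k * (m - n - n * ?s)"
    using le assms by (intro mult_left_mono) (auto simp: mode_l_nonneg)
  \<comment> \<open>Strictness comes from the upper bound, which makes the common factor positive;
    the chain closes on its own starting term.\<close>
  also have "\<dots> < pi\<^sup>2 * mode_l k' * (m - n - n * ?s)"
    using lambda_plus_less[OF assms(1,2), of k'] assms by (intro mult_strict_right_mono) auto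
  finally show False by simp
qed

theorem lemma3p1:
  fixes m n :: real
  assumes "n > 0" and "m > n"
  shows "(\<forall>(k :: nat ^ 'd) (k' :: nat ^ 'd). sqrt (mode_l k) < sqrt (mode_l k') \<longrightarrow>
             lambda_plus n m k < lambda_plus n m k')
       \<and> lambda_plus n m (0 :: nat ^ 'd) = 0
       \<and> (\<forall>k :: nat ^ 'd. k \<noteq> 0 \<longrightarrow>
             0 < lambda_plus n m k \<and> lambda_plus n m k < (m - n) / n)"
  using assms
  by (simp add: lambda_plus_strict_mono lambda_plus_0 lambda_plus_pos lambda_plus_less
      pos_less_divide_eq mult.commute)

end
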